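(* Let $\mathcal{E}^2$ be a classical overlapping generations economy with fiat money satisfying the standing assumptions listed in the context, let $\mathcal{H}^2$ be its set of monetary equilibria (with the price of money normalized to $1$), let $\mathcal{E}^G$ be the associated economy with Government, $\mathcal{H}^G\subseteq\mathbb{R}^\infty_+\times\mathbb{R}^\infty_{++}$ its set of equilibria, and let $\rho:\mathcal{H}^G\to\mathbb{R}^\infty_{++}$, $\rho(r,q)=p$, be given by $p_1=q_1$ and $p_t=q_t/\prod_{i=1}^{t-1}(1+r_i)$ for $t\ge2$. Then: (i) for every monetary policy $r\in\mathbb{R}^\infty_+$, $\{\rho(r,q)\mid (r,q)\in\mathcal{H}^G\}=\mathcal{H}^2$; (ii) if $(r,q),(r',q')\in\mathcal{H}^G$ and $\rho(r,q)=\rho(r',q')$, then $q_1=q'_1$, $q_t/\Vert q_t\Vert=q'_t/\Vert q'_t\Vert$ for all $t\ge2$, and $r^*_t=r^{*\prime}_t$ for all $t\ge1$, where $r^*_t$ and $r^{*\prime}_t$ are the real return rates $1+r^*_t=(1+r_t)\Vert q_t\Vert/\Vert q_{t+1}\Vert$ and $1+r^{*\prime}_t=(1+r'_t)\Vert q'_t\Vert/\Vert q'_{t+1}\Vert$.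
   Context: Notation: $\Vert c\Vert=\sum_i|c_i|$; $\mathbb{R}_+^n$, $\mathbb{R}_{++}^n$ are the vectors with non-negative, resp. strictly positive, coordinates; $p_t=(p_{t1},\ldots,p_{tL_t})\in\mathbb{R}^{L_t}$. Vectors indexed by the commodities of some periods are regarded as vectors over all commodities, with $0$ in the remaining coordinates. Economy $\mathcal{E}^2$: commodity periods are $t=1,2,\ldots$, with $L_t\ge1$ perishable commodities in period $t$. $G_t$ ($t\ge0$) is the (finite, non-empty) generation born in period $t$. A household $h\in G_t$, $t\ge1$, lives in periods $t,t+1$ and has consumption set $\mathbb{R}^{L_t+L_{t+1}}_+$, a nonzero endowment $e^h=(e^h_t,e^h_{t+1})\in\mathbb{R}^{L_t+L_{t+1}}_+$ and a utility $u^h:\mathbb{R}^{L_t+L_{t+1}}_+\to\mathbb{R}$. A household $h\in G_0$ has a utility $u^h:\mathbb{R}^{L_1}_+\to\mathbb{R}$, a nonzero endowment $e^h=e^h_1\in\mathbb{R}^{L_1}_+$ and an amount of fiat money $m^h\ge0$, with $\sum_{h\in G_0}m^h=1$. All utilities are continuous, non-decreasing, without local maxima and semi-strictly quasiconcave (i.e. $u(\tilde c)\ge u(c)$ implies $u(\alpha\tilde c+(1-\alpha)c)\ge u(c)$ for $0\le\alpha\le1$, and $u(\tilde c)>u(c)$ implies $u(\alpha\tilde c+(1-\alpha)c)>u(c)$ for $0<\alpha\le1$). $\sum_{t\ge0}\sum_{h\in G_t}e^h\in\mathbb{R}^\infty_{++}$. Demand in $\mathcal{E}^2$ (assumed single-valued):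 for $h\in G_t$, $t\ge1$, $x^h(p_t,p_{t+1})=(x^h_t,x^h_{t+1})(p_t,p_{t+1})$ maximizes $u^h(c)$ over $c\in\mathbb{R}^{L_t+L_{t+1}}_+$ with $(p_t,p_{t+1})\cdot(c-e^h)\le0$. For $h\in G_0$, $x^h_1(p_m,p_1)$ maximizes $u^h(c)$ over $c\in\mathbb{R}^{L_1}_+$ with $p_1\cdot(c-e^h_1)\le p_mm^h$, $(p_m,p_1)\in\mathbb{R}_+\times\mathbb{R}^{L_1}_{++}$. An equilibrium of $\mathcal{E}^2$ is $(p_m,p)$, $p_m\ge0$, $p=(p_1,p_2,\ldots)\in\mathbb{R}^\infty_{++}$, with $\sum_{h\in G_0}x^h_1(p_m,p_1)+\sum_{h\in G_1}x^h_1(p_1,p_2)=\sum_{h\in G_0\cup G_1}e^h_1$ and $\sum_{h\in G_{t-1}}x^h_t(p_{t-1},p_t)+\sum_{h\in G_t}x^h_t(p_t,p_{t+1})=\sum_{h\in G_{t-1}\cup G_t}e^h_t$ for $t\ge2$. $\mathcal{H}^2$ is the set of $p\in\mathbb{R}^\infty_{++}$ such that $(1,p)$ is an equilibrium. An equilibrium is Pareto optimal if no family of non-negative consumption bundles with the same aggregate as the equilibrium allocation gives every household at least its equilibrium utility and some household strictly more. Standing assumptions on $\mathcal{E}^2$: (a) there are $0<\alpha_{\min}<\alpha_{\max}$ with $\sum_{h\in G_{t+1}}\Vert e^h_{t+1}\Vert/\sum_{h\in G_t}\Vert e^h_{t+1}\Vert\in(\alpha_{\min},\alpha_{\max})$ for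 all $t\ge0$; put $\beta=\max\{1+\alpha_{\min}^{-1},1+\alpha_{\max}\}$. (b) For every $j\ge0$ all households in $\bigcup_{t=0}^jG_t$ are indirectly resource related to one another, where $h'$ is resource related to $h''$ if for every family of non-negative consumption bundles $\{c^h\}_{h\in\bigcup_{t=0}^jG_t}$ with $\sum_hc^h\le\sum_he^h$ there are another such family $\{\tilde c^h\}$ and $y\ge0$ over the commodities of periods $1,\ldots,j+1$ with $\sum_h\tilde c^h\le\sum_he^h+y$, $u^h(\tilde c^h)\ge u^h(c^h)$ for all $h$, $u^{h''}(\tilde c^{h''})>u^{h''}(c^{h''})$, and $y_{ti}>0$ only if $e^{h'}_{ti}>0$; "indirectly" means via a finite chain of households each resource related to the next. (c) An equilibrium $(p_m,p)$ of $\mathcal{E}^2$ is Pareto optimal iff $\sum_{t=1}^\infty(\Vert p_t\Vert\sum_{h\in G_t}\Vert e^h_t\Vert)^{-1}=+\infty$. (d) With $\mathcal{B}_t(\sigma)=\{p\in\mathbb{R}^{L_t+L_{t+1}}_{++}\mid\sigma\le p_i\le\sigma^{-1}\ \forall i\}$, for all $t\ge1$ there is $\sigma_t\in(0,1)$ such that $(p_t/p_{t1},p_{t+1}/p_{t1})\notin\mathcal{B}_t(\sigma_t)$ implies $\sum_{h\in G_t}\Vert x^h(p_t,p_{t+1})\Vert>\beta\sum_{h\in G_t}\Vert e^h\Vert$; moreover $\inf_{t\ge1}\sigma_t>0$ and $\sup_{t\ge1}L_t<\infty$. (e) With $s^h(p_t,p_{t+1})=\frac{p_t}{\Vert p_t\Vert}\cdot(e^h_t-x^h_t(p_t,p_{t+1}))$,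 there are $\varepsilon,\delta>0$ such that for all $t\ge1$ and $(p_t/p_{t1},p_{t+1}/p_{t1})\in\mathcal{B}_t(\sigma_t)$, $\sum_{h\in G_t}s^h(p_t,p_{t+1})\le\delta\sum_{h\in G_t}\Vert e^h_t\Vert$ implies $\frac{\Vert p_t\Vert}{\Vert p_{t+1}\Vert}\le\frac1{1+\varepsilon}\frac{\sum_{h\in G_{t+1}}\Vert e^h_{t+1}\Vert}{\sum_{h\in G_t}\Vert e^h_t\Vert}$. (f) There is $\lambda>0$ such that for $p_1\in\mathbb{R}^{L_1}_{++}$, $\min_ip_{1i}<\lambda$ implies $\sum_{h\in G_0}\Vert x^h_1(1,p_1)\Vert>\beta\sum_{h\in G_0}\Vert e^h_1\Vert$. Economy $\mathcal{E}^G$: same preferences and endowments as $\mathcal{E}^2$. A monetary policy is a sequence of nominal interest rates $r=(r_1,r_2,\ldots)\in\mathbb{R}^\infty_+$; $q=(q_1,q_2,\ldots)\in\mathbb{R}^\infty_{++}$, $q_t\in\mathbb{R}^{L_t}_{++}$, is a sequence of spot prices in current money. Household $h\in G_t$, $t\ge1$, demands $\tilde x^h(r_t,q_t,q_{t+1})=(\tilde x^h_t,\tilde x^h_{t+1})$, the maximizer of $u^h(c)$ over $c\in\mathbb{R}^{L_t+L_{t+1}}_+$ with $(q_t,(1+r_t)^{-1}q_{t+1})\cdot(c-e^h)=0$. Household $h\in G_0$ holds $b^h=m^h$ government bonds and demands $\tilde x^h_1(q_1)$, the maximizer of $u^h(c)$ over $c\in\mathbb{R}^{L_1}_+$ with $q_1\cdot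 c=b^h+q_1\cdot e^h_1$. $(r,q)\in\mathbb{R}^\infty_+\times\mathbb{R}^\infty_{++}$ is an equilibrium of $\mathcal{E}^G$ if $\sum_{h\in G_0}\tilde x^h_1(q_1)+\sum_{h\in G_1}\tilde x^h_1(r_1,q_1,q_2)=\sum_{h\in G_0}e^h_1+\sum_{h\in G_1}e^h_1$ and $\sum_{h\in G_{t-1}}\tilde x^h_t(r_{t-1},q_{t-1},q_t)+\sum_{h\in G_t}\tilde x^h_t(r_t,q_t,q_{t+1})=\sum_{h\in G_{t-1}}e^h_t+\sum_{h\in G_t}e^h_t$ for $t\ge2$; $\mathcal{H}^G$ is the set of these. *)

theory Defs
  imports "HOL-Analysis.Analysis"
begin

text \<open>
  A vector over commodities is a function of the period \<open>s\<close> and of the good \<open>i\<close> within that period.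
  Periods are numbered from \<open>1\<close> and the goods of period \<open>s\<close> are \<open>1, \<dots>, goods E s\<close>; all other
  coordinates of a vector are \<open>0\<close>.  In particular vectors over the commodities of some periods
  are literally vectors over all commodities.
\<close>

type_synonym cvector = "nat \<Rightarrow> nat \<Rightarrow> real"

record 'h og_economy =
  goods :: "nat \<Rightarrow> nat"
  gen :: "nat \<Rightarrow> 'h set"
  endow :: "'h \<Rightarrow> cvector"
  util :: "'h \<Rightarrow> cvector \<Rightarrow> real"
  money :: "'h \<Rightarrow> real"  \<comment> \<open>only relevant on generation 0\<close>

definition bundles :: "'h og_economy \<Rightarrow> nat set \<Rightarrow> cvector set" where
  "bundles E T = {c. \<forall>s i. if s \<in> T \<and> i \<in> {1..goods E s} then 0 \<le> c s i else c s i = 0}"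

definition prices :: "'h og_economy \<Rightarrow> nat set \<Rightarrow> cvector set" where
  "prices E T = {p. \<forall>s i. if s \<in> T \<and> i \<in> {1..goods E s} then 0 < p s i else p s i = 0}"

definition inner_on :: "'h og_economy \<Rightarrow> nat set \<Rightarrow> cvector \<Rightarrow> cvector \<Rightarrow> real" where
  "inner_on E T p c = (\<Sum>s\<in>T. \<Sum>i=1..goods E s. p s i * c s i)"

definition norm_on :: "'h og_economy \<Rightarrow> nat set \<Rightarrow> cvector \<Rightarrow> real" where
  "norm_on E T c = (\<Sum>s\<in>T. \<Sum>i=1..goods E s. \<bar>c s i\<bar>)"

text \<open>Generation \<open>0\<close> lives in period \<open>1\<close> only.\<close>

definition life :: "nat \<Rightarrow> nat set" where
  "life t = (if t = 0 then {1} else {t, t + 1})"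


section \<open>Households\<close>

text \<open>
  A consumption set involves only finitely many coordinates that can be nonzero, so the
  product topology on \<^typ>\<open>cvector\<close> induces its Euclidean topology.
\<close>

definition no_local_max_on :: "cvector set \<Rightarrow> (cvector \<Rightarrow> real) \<Rightarrow> bool" where
  "no_local_max_on X v \<longleftrightarrow> (\<forall>c\<in>X. \<not> (\<forall>\<^sub>F c' in at c within X. v c' \<le> v c))"

definition semistrictly_quasiconcave_on :: "cvector set \<Rightarrow> (cvector \<Rightarrow> real) \<Rightarrow> bool" where
  "semistrictly_quasiconcave_on X v \<longleftrightarrow>
     (\<forall>c\<in>X. \<forall>c'\<in>X.
        (v c' \<ge> v c \<longrightarrow>
          (\<forall>a. 0 \<le> a \<and> a \<le> 1 \<longrightarrow> v (\<lambda>s i. a * c' s i + (1 - a) * c s i) \<ge> v c)) \<and>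
        (v c' > v c \<longrightarrow>
          (\<forall>a. 0 < a \<and> a \<le> 1 \<longrightarrow> v (\<lambda>s i. a * c' s i + (1 - a) * c s i) > v c)))"

definition og_economy :: "'h og_economy \<Rightarrow> bool" where
  "og_economy E \<longleftrightarrow>
     (\<forall>t\<ge>1. goods E t \<ge> 1) \<and>
     (\<forall>t. finite (gen E t) \<and> gen E t \<noteq> {}) \<and>
     disjoint_family (gen E) \<and>
     (\<forall>t. \<forall>h\<in>gen E t.
        endow E h \<in> bundles E (life t) \<and> endow E h \<noteq> (\<lambda>_ _. 0) \<and>
        continuous_on (bundles E (life t)) (util E h) \<and>
        mono_on (bundles E (life t)) (util E h) \<and>
        no_local_max_on (bundles E (life t)) (util E h) \<and>
        semistrictly_quasiconcave_on (bundles E (life t)) (util E h)) \<and>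
     (\<forall>h\<in>gen E 0. money E h \<ge> 0) \<and>
     (\<Sum>h\<in>gen E 0. money E h) = 1 \<and>
     (\<forall>t\<ge>1. \<forall>i\<in>{1..goods E t}. (\<Sum>h\<in>gen E (t - 1) \<union> gen E t. endow E h t i) > 0)"


section \<open>The economy with fiat money\<close>

definition budget :: "'h og_economy \<Rightarrow> nat \<Rightarrow> cvector \<Rightarrow> 'h \<Rightarrow> cvector set" where
  "budget E t p h =
     {c \<in> bundles E {t, t + 1}. inner_on E {t, t + 1} p (\<lambda>s i. c s i - endow E h s i) \<le> 0}"

definition budget_old :: "'h og_economy \<Rightarrow> real \<Rightarrow> cvector \<Rightarrow> 'h \<Rightarrow> cvector set" where
  "budget_old E pm p h =
     {c \<in> bundles E {1}. inner_on E {1} p (\<lambda>s i. c s i - endow E h s i) \<le> pm * money E h}"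

definition single_valued_demand :: "'h og_economy \<Rightarrow> bool" where
  "single_valued_demand E \<longleftrightarrow>
     (\<forall>t\<ge>1. \<forall>h\<in>gen E t. \<forall>p\<in>prices E {t, t + 1}.
        \<exists>!c. is_arg_max (util E h) (\<lambda>c. c \<in> budget E t p h) c) \<and>
     (\<forall>h\<in>gen E 0. \<forall>pm\<ge>0. \<forall>p\<in>prices E {1}.
        \<exists>!c. is_arg_max (util E h) (\<lambda>c. c \<in> budget_old E pm p h) c)"

text \<open>
  The demand of a household of generation \<open>t \<ge> 1\<close> reads the price vector in periods \<open>t\<close> and
  \<open>t + 1\<close> only, that of a household of generation \<open>0\<close> in period \<open>1\<close> only.
\<close>

definition demand :: "'h og_economy \<Rightarrow> nat \<Rightarrow> cvector \<Rightarrow> 'h \<Rightarrow> cvector" where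
  "demand E t p h = arg_max_on (util E h) (budget E t p h)"

definition demand_old :: "'h og_economy \<Rightarrow> real \<Rightarrow> cvector \<Rightarrow> 'h \<Rightarrow> cvector" where
  "demand_old E pm p h = arg_max_on (util E h) (budget_old E pm p h)"

definition equilibrium :: "'h og_economy \<Rightarrow> real \<Rightarrow> cvector \<Rightarrow> bool" where
  "equilibrium E pm p \<longleftrightarrow>
     pm \<ge> 0 \<and> p \<in> prices E {1..} \<and>
     (\<forall>i\<in>{1..goods E 1}.
        (\<Sum>h\<in>gen E 0. demand_old E pm p h 1 i) + (\<Sum>h\<in>gen E 1. demand E 1 p h 1 i)
          = (\<Sum>h\<in>gen E 0 \<union> gen E 1. endow E h 1 i)) \<and>
     (\<forall>t\<ge>2. \<forall>i\<in>{1..goods E t}.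
        (\<Sum>h\<in>gen E (t - 1). demand E (t - 1) p h t i) + (\<Sum>h\<in>gen E t. demand E t p h t i)
          = (\<Sum>h\<in>gen E (t - 1) \<union> gen E t. endow E h t i))"

definition monetary_equilibria :: "'h og_economy \<Rightarrow> cvector set" where
  "monetary_equilibria E = {p. equilibrium E 1 p}"

definition allocation :: "'h og_economy \<Rightarrow> real \<Rightarrow> cvector \<Rightarrow> nat \<Rightarrow> 'h \<Rightarrow> cvector" where
  "allocation E pm p t h = (if t = 0 then demand_old E pm p h else demand E t p h)"

definition pareto_optimal :: "'h og_economy \<Rightarrow> real \<Rightarrow> cvector \<Rightarrow> bool" where
  "pareto_optimal E pm p \<longleftrightarrow>
     \<not> (\<exists>c. (\<forall>t. \<forall>h\<in>gen E t. c h \<in> bundles E (life t)) \<and>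
            (\<forall>t\<ge>1. \<forall>i\<in>{1..goods E t}.
               (\<Sum>h\<in>gen E (t - 1). c h t i) + (\<Sum>h\<in>gen E t. c h t i) =
               (\<Sum>h\<in>gen E (t - 1). allocation E pm p (t - 1) h t i) +
               (\<Sum>h\<in>gen E t. allocation E pm p t h t i)) \<and>
            (\<forall>t. \<forall>h\<in>gen E t. util E h (c h) \<ge> util E h (allocation E pm p t h)) \<and>
            (\<exists>t. \<exists>h\<in>gen E t. util E h (c h) > util E h (allocation E pm p t h)))"


section \<open>Standing assumptions\<close>

definition resource_ratio_bounds :: "'h og_economy \<Rightarrow> real \<Rightarrow> real \<Rightarrow> bool" where
  "resource_ratio_bounds E amin amax \<longleftrightarrow>
     0 < amin \<and> amin < amax \<and>
     (\<forall>t. (\<Sum>h\<in>gen E (t + 1). norm_on E {t + 1} (endow E h)) /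
          (\<Sum>h\<in>gen E t. norm_on E {t + 1} (endow E h)) \<in> {amin<..<amax})"

definition resource_bound :: "real \<Rightarrow> real \<Rightarrow> real" where
  "resource_bound amin amax = max (1 + inverse amin) (1 + amax)"

definition households_upto :: "'h og_economy \<Rightarrow> nat \<Rightarrow> 'h set" where
  "households_upto E j = (\<Union>t\<in>{0..j}. gen E t)"

definition consumption_family :: "'h og_economy \<Rightarrow> nat \<Rightarrow> ('h \<Rightarrow> cvector) \<Rightarrow> bool" where
  "consumption_family E j c \<longleftrightarrow> (\<forall>t\<le>j. \<forall>h\<in>gen E t. c h \<in> bundles E (life t))"

definition resource_related :: "'h og_economy \<Rightarrow> nat \<Rightarrow> 'h \<Rightarrow> 'h \<Rightarrow> bool" where
  "resource_related E j h' h'' \<longleftrightarrow>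
     h' \<in> households_upto E j \<and> h'' \<in> households_upto E j \<and>
     (\<forall>c. consumption_family E j c \<and>
          (\<forall>s i. (\<Sum>h\<in>households_upto E j. c h s i) \<le> (\<Sum>h\<in>households_upto E j. endow E h s i)) \<longrightarrow>
        (\<exists>c' y. consumption_family E j c' \<and> y \<in> bundles E {1..j + 1} \<and>
           (\<forall>s i. (\<Sum>h\<in>households_upto E j. c' h s i)
                    \<le> (\<Sum>h\<in>households_upto E j. endow E h s i) + y s i) \<and>
           (\<forall>h\<in>households_upto E j. util E h (c' h) \<ge> util E h (c h)) \<and>
           util E h'' (c' h'') > util E h'' (c h'') \<and>
           (\<forall>s i. y s i > 0 \<longrightarrow> endow E h' s i > 0)))"

text \<open>
  The closure is reflexive: nothing is required of a household paired with itself.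
\<close>

definition indirectly_resource_related :: "'h og_economy \<Rightarrow> bool" where
  "indirectly_resource_related E \<longleftrightarrow>
     (\<forall>j. \<forall>h'\<in>households_upto E j. \<forall>h''\<in>households_upto E j. (resource_related E j)\<^sup>*\<^sup>* h' h'')"

definition pareto_criterion :: "'h og_economy \<Rightarrow> bool" where
  "pareto_criterion E \<longleftrightarrow>
     (\<forall>pm p. equilibrium E pm p \<longrightarrow>
        (pareto_optimal E pm p \<longleftrightarrow>
         filterlim
           (\<lambda>n. \<Sum>t=1..n. inverse (norm_on E {t} p * (\<Sum>h\<in>gen E t. norm_on E {t} (endow E h))))
           at_top sequentially))"

definition price_box :: "'h og_economy \<Rightarrow> nat \<Rightarrow> real \<Rightarrow> cvector set" where
  "price_box E t \<sigma> =
     {p \<in> prices E {t, t + 1}. \<forall>s\<in>{t, t + 1}. \<forall>i\<in>{1..goods E s}. \<sigma> \<le> p s i \<and> p s i \<le> inverse \<sigma>}"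

definition normalize_prices :: "nat \<Rightarrow> cvector \<Rightarrow> cvector" where
  "normalize_prices t p = (\<lambda>s i. p s i / p t 1)"

definition demand_explodes :: "'h og_economy \<Rightarrow> real \<Rightarrow> (nat \<Rightarrow> real) \<Rightarrow> bool" where
  "demand_explodes E \<beta> \<sigma> \<longleftrightarrow>
     (\<forall>t\<ge>1. \<sigma> t \<in> {0<..<1} \<and>
        (\<forall>p\<in>prices E {t, t + 1}. normalize_prices t p \<notin> price_box E t (\<sigma> t) \<longrightarrow>
           (\<Sum>h\<in>gen E t. norm_on E {t, t + 1} (demand E t p h))
             > \<beta> * (\<Sum>h\<in>gen E t. norm_on E {t, t + 1} (endow E h)))) \<and>
     (INF t\<in>{1..}. \<sigma> t) > 0 \<and>
     bdd_above (goods E ` {1..})"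

definition savings :: "'h og_economy \<Rightarrow> nat \<Rightarrow> cvector \<Rightarrow> 'h \<Rightarrow> real" where
  "savings E t p h =
     inner_on E {t} (\<lambda>s i. p s i / norm_on E {t} p) (\<lambda>s i. endow E h s i - demand E t p h s i)"

definition low_savings_condition :: "'h og_economy \<Rightarrow> (nat \<Rightarrow> real) \<Rightarrow> bool" where
  "low_savings_condition E \<sigma> \<longleftrightarrow>
     (\<exists>\<epsilon>>0. \<exists>\<delta>>0. \<forall>t\<ge>1. \<forall>p\<in>prices E {t, t + 1}.
        normalize_prices t p \<in> price_box E t (\<sigma> t) \<longrightarrow>
        (\<Sum>h\<in>gen E t. savings E t p h) \<le> \<delta> * (\<Sum>h\<in>gen E t. norm_on E {t} (endow E h)) \<longrightarrow>
        norm_on E {t} p / norm_on E {t + 1} p \<le>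
          1 / (1 + \<epsilon>) * ((\<Sum>h\<in>gen E (t + 1). norm_on E {t + 1} (endow E h)) /
                          (\<Sum>h\<in>gen E t. norm_on E {t} (endow E h))))"

definition old_demand_explodes :: "'h og_economy \<Rightarrow> real \<Rightarrow> bool" where
  "old_demand_explodes E \<beta> \<longleftrightarrow>
     (\<exists>l>0. \<forall>p\<in>prices E {1}. Min (p 1 ` {1..goods E 1}) < l \<longrightarrow>
        (\<Sum>h\<in>gen E 0. norm_on E {1} (demand_old E 1 p h))
          > \<beta> * (\<Sum>h\<in>gen E 0. norm_on E {1} (endow E h)))"

definition standing_assumptions :: "'h og_economy \<Rightarrow> bool" where
  "standing_assumptions E \<longleftrightarrow>
     indirectly_resource_related E \<and>
     pareto_criterion E \<and>
     (\<exists>amin amax \<sigma>.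
        resource_ratio_bounds E amin amax \<and>
        demand_explodes E (resource_bound amin amax) \<sigma> \<and>
        low_savings_condition E \<sigma> \<and>
        old_demand_explodes E (resource_bound amin amax))"


section \<open>The economy with Government\<close>

text \<open>Sequences of interest rates are indexed from \<open>1\<close>; the value at \<open>0\<close> is a placeholder.\<close>

definition monetary_policies :: "(nat \<Rightarrow> real) set" where
  "monetary_policies = {r. r 0 = 0 \<and> (\<forall>t\<ge>1. r t \<ge> 0)}"

definition gov_demand :: "'h og_economy \<Rightarrow> nat \<Rightarrow> real \<Rightarrow> cvector \<Rightarrow> 'h \<Rightarrow> cvector" where
  "gov_demand E t rt q h = arg_max_on (util E h)
     {c \<in> bundles E {t, t + 1}.
        inner_on E {t} q (\<lambda>s i. c s i - endow E h s i) +
        inverse (1 + rt) * inner_on E {t + 1} q (\<lambda>s i. c s i - endow E h s i) = 0}"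

text \<open>The initial holding of government bonds of a household equals its amount of fiat money.\<close>

definition gov_demand_old :: "'h og_economy \<Rightarrow> cvector \<Rightarrow> 'h \<Rightarrow> cvector" where
  "gov_demand_old E q h = arg_max_on (util E h)
     {c \<in> bundles E {1}. inner_on E {1} q c = money E h + inner_on E {1} q (endow E h)}"

definition government_equilibria :: "'h og_economy \<Rightarrow> ((nat \<Rightarrow> real) \<times> cvector) set" where
  "government_equilibria E =
     {(r, q). r \<in> monetary_policies \<and> q \<in> prices E {1..} \<and>
        (\<forall>i\<in>{1..goods E 1}.
           (\<Sum>h\<in>gen E 0. gov_demand_old E q h 1 i) + (\<Sum>h\<in>gen E 1. gov_demand E 1 (r 1) q h 1 i)
             = (\<Sum>h\<in>gen E 0. endow E h 1 i) + (\<Sum>h\<in>gen E 1. endow E h 1 i)) \<and>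
        (\<forall>t\<ge>2. \<forall>i\<in>{1..goods E t}.
           (\<Sum>h\<in>gen E (t - 1). gov_demand E (t - 1) (r (t - 1)) q h t i) +
           (\<Sum>h\<in>gen E t. gov_demand E t (r t) q h t i)
             = (\<Sum>h\<in>gen E (t - 1). endow E h t i) + (\<Sum>h\<in>gen E t. endow E h t i))}"

definition rho :: "(nat \<Rightarrow> real) \<Rightarrow> cvector \<Rightarrow> cvector" where
  "rho r q = (\<lambda>t i. q t i / (\<Prod>k\<in>{1..<t}. 1 + r k))"

definition real_return :: "'h og_economy \<Rightarrow> (nat \<Rightarrow> real) \<Rightarrow> cvector \<Rightarrow> nat \<Rightarrow> real" where
  "real_return E r q t = (1 + r t) * norm_on E {t} q / norm_on E {t + 1} q - 1"

end

theory Submission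
  imports Defs
begin

text \<open>
  Without local maxima the budget constraint binds at the optimum, so the budget inequality of the
  money economy may be replaced by the budget equation of the economy with Government.  With
  \<open>p = rho r q\<close> the budget hyperplanes of the two economies are the same, hence the demands are the
  same, and so are the market clearing conditions.  For fixed \<open>r\<close> the map \<open>rho r\<close> rescales every
  period by a positive factor, so it is invertible on positive prices and preserves relative prices
  within a period.
\<close>

text \<open>If the maximizer \<open>x\<close> had \<open>g x < k\<close>, continuity would keep
  \<open>g < k\<close> near \<open>x\<close>, so \<open>x\<close> would be a local maximum of
  \<open>u\<close> on \<open>X\<close>. Hence \<open>x\<close> satisfies the equation. Any maximizer
  under the equation does at least as well as \<open>x\<close>, so it also maximizes under the
  inequality and equals \<open>x\<close> by uniqueness.\<close>

lemma arg_max_on_constraint_binds: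
  fixes u g :: "'a::topological_space \<Rightarrow> real"
  assumes ex1: "\<exists>!c. is_arg_max u (\<lambda>c. c \<in> {c \<in> X. g c \<le> k}) c"
    and cont: "continuous_on X g"
    and nolocmax: "\<And>c. c \<in> X \<Longrightarrow> \<not> (\<forall>\<^sub>F c' in at c within X. u c' \<le> u c)"
  shows "arg_max_on u {c \<in> X. g c = k} = arg_max_on u {c \<in> X. g c \<le> k}"
proof -
  obtain x where x: "is_arg_max u (\<lambda>c. c \<in> {c \<in> X. g c \<le> k}) x"
    and uniq: "\<And>y. is_arg_max u (\<lambda>c. c \<in> {c \<in> X. g c \<le> k}) y \<Longrightarrow> y = x"
    using ex1 by blast
  have xX: "x \<in> X" and gx: "g x \<le> k" and best: "\<And>y. y \<in> X \<Longrightarrow> g y \<le> k \<Longrightarrow> u y \<le> u x"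
    using x by (auto simp: is_arg_max_linorder)
  have "g x = k"
  proof (rule ccontr)
    assume "g x \<noteq> k"
    with gx have "g x < k" by simp
    moreover have "(g \<longlongrightarrow> g x) (at x within X)"
      using cont xX by (simp add: continuous_on_def)
    ultimately have "\<forall>\<^sub>F c in at x within X. g c < k"
      by (rule order_tendstoD(2)[rotated])
    moreover have "\<forall>\<^sub>F c in at x within X. c \<in> X"
      by (simp add: eventually_at_filter)
    ultimately have "\<forall>\<^sub>F c in at x within X. u c \<le> u x"
      by eventually_elim (simp add: best)
    with nolocmax[OF xX] show False by contradiction
  qed
  have "is_arg_max u (\<lambda>c. c \<in> {c \<in> X. g c = k}) y \<longleftrightarrow> y = x" for y
  proof
    assume y: "is_arg_max u (\<lambda>c. c \<in> {c \<in> X. g c = k}) y"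
    then have "u x \<le> u y"
      using xX \<open>g x = k\<close> by (auto simp: is_arg_max_linorder)
    with y best have "is_arg_max u (\<lambda>c. c \<in> {c \<in> X. g c \<le> k}) y"
      by (force simp: is_arg_max_linorder)
    then show "y = x" by (rule uniq)
  next
    assume "y = x"
    then show "is_arg_max u (\<lambda>c. c \<in> {c \<in> X. g c = k}) y"
      using xX \<open>g x = k\<close> best by (auto simp: is_arg_max_linorder)
  qed
  moreover have "is_arg_max u (\<lambda>c. c \<in> {c \<in> X. g c \<le> k}) y \<longleftrightarrow> y = x" for y
    using x uniq by blast
  \<comment> \<open>\<open>arg_max_on\<close> is a choice operator, so equal maximal values would
    not suffice. The two choices agree because both predicates amount to
    \<open>y = x\<close>.\<close>
  ultimately show ?thesis
    by (simp only: arg_max_on_def arg_max_def)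
qed

text \<open>Coordinate projections are continuous in the product topology; the projection rule is
  applied twice because \<open>cvector\<close> is curried.\<close>

lemma continuous_on_inner_on:
  "continuous_on X (\<lambda>c. inner_on E T p (\<lambda>s i. c s i - e s i))"
  unfolding inner_on_def
  by (intro continuous_intros continuous_on_product_then_coordinatewise[OF
        continuous_on_product_then_coordinatewise[OF continuous_on_id]])

lemma inner_on_cong:
  assumes "\<And>s i. s \<in> T \<Longrightarrow> p s i = p' s i"
  shows "inner_on E T p c = inner_on E T p' c"
  using assms by (simp add: inner_on_def)

lemma inner_on_diff_right:
  "inner_on E T p (\<lambda>s i. c s i - e s i) = inner_on E T p c - inner_on E T p e"
  by (simp add: inner_on_def right_diff_distrib sum_subtractf)

lemma inner_on_singleton_divide:
  "inner_on E {s} (\<lambda>s i. p s i / a s) c = inner_on E {s} p c / a s"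
  by (simp add: inner_on_def sum_divide_distrib)

lemma norm_on_singleton_divide:
  assumes "a s > 0"
  shows "norm_on E {s} (\<lambda>s i. p s i / a s) = norm_on E {s} p / a s"
  using assms by (simp add: norm_on_def sum_divide_distrib)

text \<open>\<open>single_valued_demand\<close> speaks of price vectors that vanish outside a
  household's lifetime, whereas equilibrium prices cover all periods. Truncation bridges the
  two.\<close>

lemma restrict_prices:
  assumes "p \<in> prices E T'" "T \<subseteq> T'"
  shows "(\<lambda>s i. if s \<in> T then p s i else 0) \<in> prices E T"
  unfolding prices_def
proof (intro CollectI allI)
  fix s i
  show "if s \<in> T \<and> i \<in> {1..goods E s} then 0 < (if s \<in> T then p s i else 0)
    else (if s \<in> T then p s i else 0) = 0"
    using assms by (cases "s \<in> T") (auto simp: prices_def dest: spec[of _ s])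
qed

lemma policy_factor_pos:
  assumes "r \<in> monetary_policies"
  shows "0 < (\<Prod>k\<in>{1..<t}. 1 + r k)"
  using assms by (intro prod_pos) (simp add: monetary_policies_def add_pos_nonneg)

text \<open>\<open>rho\<close> discounts spot prices to period 1. The right-hand inner product is
  the left-hand expression divided by the positive discount product up to period \<open>t\<close>,
  so both vanish together.\<close>

lemma gov_budget_eq:
  assumes "r \<in> monetary_policies" "1 \<le> t"
  shows "inner_on E {t} q c + inverse (1 + r t) * inner_on E {t + 1} q c = 0 \<longleftrightarrow>
    inner_on E {t, t + 1} (rho r q) c = 0"
proof -
  let ?P = "\<Prod>k\<in>{1..<t}. 1 + r k"
  have P: "?P > 0"
    using assms(1) by (rule policy_factor_pos)
  have P': "(\<Prod>k\<in>{1..<t + 1}. 1 + r k) = ?P * (1 + r t)"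
    using assms(2) by simp
  have "inner_on E {t, t + 1} (rho r q) c =
    inner_on E {t} (rho r q) c + inner_on E {t + 1} (rho r q) c"
    by (simp add: inner_on_def)
  also have "\<dots> = inner_on E {t} q c / ?P + inner_on E {t + 1} q c / (?P * (1 + r t))"
    unfolding rho_def inner_on_singleton_divide P' ..
  also have "\<dots> = (inner_on E {t} q c + inverse (1 + r t) * inner_on E {t + 1} q c) / ?P"
    by (simp add: divide_simps)
  finally show ?thesis
    using P by (simp only: divide_eq_0_iff less_imp_neq[symmetric] simp_thms)
qed

lemma demand_eq_arg_max_on_hyperplane:
  assumes "og_economy E" "single_valued_demand E" "1 \<le> t" "h \<in> gen E t" "p \<in> prices E {1..}"
  shows "demand E t p h = arg_max_on (util E h)
    {c \<in> bundles E {t, t + 1}. inner_on E {t, t + 1} p (\<lambda>s i. c s i - endow E h s i) = 0}"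
proof -
  let ?p = "\<lambda>s i. if s \<in> {t, t + 1} then p s i else 0"
  have "?p \<in> prices E {t, t + 1}"
    using assms(3,5) by (intro restrict_prices) auto
  with assms(2-4) have "\<exists>!c. is_arg_max (util E h) (\<lambda>c. c \<in> budget E t ?p h) c"
    unfolding single_valued_demand_def by blast
  \<comment> \<open>The budget set reads prices in periods \<open>t\<close> and \<open>t + 1\<close>
    only, so truncation does not change it.\<close>
  moreover have "budget E t ?p h = budget E t p h"
    unfolding budget_def by (subst inner_on_cong[of _ ?p p]) auto
  ultimately have "\<exists>!c. is_arg_max (util E h) (\<lambda>c. c \<in> budget E t p h) c"
    by simp
  moreover have "no_local_max_on (bundles E {t, t + 1}) (util E h)"
    using assms(1,3,4) by (auto simp: og_economy_def life_def split: if_splits)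
  ultimately show ?thesis
    unfolding demand_def budget_def
    by (intro arg_max_on_constraint_binds[symmetric] continuous_on_inner_on)
      (auto simp: no_local_max_on_def)
qed

lemma gov_demand_eq_demand:
  assumes "og_economy E" "single_valued_demand E" "1 \<le> t" "h \<in> gen E t"
    and "r \<in> monetary_policies" "rho r q \<in> prices E {1..}"
  shows "gov_demand E t (r t) q h = demand E t (rho r q) h"
  unfolding gov_demand_def
  by (simp only: gov_budget_eq assms(3,5) demand_eq_arg_max_on_hyperplane[OF assms(1-4,6)])

lemma gov_demand_old_eq_demand_old:
  assumes "og_economy E" "single_valued_demand E" "h \<in> gen E 0" "rho r q \<in> prices E {1..}"
  shows "gov_demand_old E q h = demand_old E 1 (rho r q) h"
proof -
  let ?q = "\<lambda>s i. if s \<in> {1} then rho r q s i else 0"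
  have "?q \<in> prices E {1}"
    using assms(4) by (intro restrict_prices) auto
  with assms(2,3) have "\<exists>!c. is_arg_max (util E h) (\<lambda>c. c \<in> budget_old E 1 ?q h) c"
    unfolding single_valued_demand_def
    by (elim conjE ballE[of _ _ h] allE[of _ 1] impE ballE[of _ _ ?q]) simp_all
  moreover have "budget_old E 1 ?q h = budget_old E 1 (rho r q) h"
    unfolding budget_old_def by (subst inner_on_cong[of _ ?q "rho r q"]) auto
  ultimately have ex1: "\<exists>!c. is_arg_max (util E h) (\<lambda>c. c \<in> budget_old E 1 (rho r q) h) c"
    by simp
  have nl: "no_local_max_on (bundles E {1}) (util E h)"
    using assms(1,3) by (force simp: og_economy_def life_def)
  \<comment> \<open>In period 1 the discount product is empty, so \<open>rho\<close> leaves the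
    prices unchanged.\<close>
  have q: "inner_on E {1} (rho r q) c = inner_on E {1} q c" for c
    by (rule inner_on_cong) (simp add: rho_def)
  \<comment> \<open>The factor in \<open>1 * money E h\<close> is the price of money; it matches the
    right-hand side of \<open>budget_old\<close> at \<open>pm = 1\<close>.\<close>
  have "gov_demand_old E q h = arg_max_on (util E h) {c \<in> bundles E {1}.
    inner_on E {1} (rho r q) (\<lambda>s i. c s i - endow E h s i) = 1 * money E h}"
    by (simp add: gov_demand_old_def q inner_on_diff_right algebra_simps del: One_nat_def)
  also have "\<dots> = demand_old E 1 (rho r q) h"
    unfolding demand_old_def budget_old_def
    using ex1 nl by (intro arg_max_on_constraint_binds continuous_on_inner_on)
      (auto simp: budget_old_def no_local_max_on_def)
  finally show ?thesis .
qed

lemma rho_in_prices_iff: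
  assumes "r \<in> monetary_policies"
  shows "rho r q \<in> prices E {1..} \<longleftrightarrow> q \<in> prices E {1..}"
proof -
  have "0 < rho r q s i \<longleftrightarrow> 0 < q s i" and "rho r q s i = 0 \<longleftrightarrow> q s i = 0" for s i
    using policy_factor_pos[OF assms, of s] by (auto simp: rho_def zero_less_divide_iff simp del: prod_zero_iff)
  then show ?thesis
    by (simp add: prices_def)
qed

lemma government_equilibrium_iff:
  assumes "og_economy E" "single_valued_demand E" "r \<in> monetary_policies"
  shows "(r, q) \<in> government_equilibria E \<longleftrightarrow> rho r q \<in> monetary_equilibria E"
proof (cases "rho r q \<in> prices E {1..}")
  case True
  \<comment> \<open>One economy sums endowments over each generation, the other over the union of
    two; disjointness of generations reconciles them.\<close>
  have sums: "(\<Sum>h\<in>gen E t. endow E h s i) + (\<Sum>h\<in>gen E t'. endow E h s i) =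
    (\<Sum>h\<in>gen E t \<union> gen E t'. endow E h s i)" if "t \<noteq> t'" for s i t t'
    using assms(1) that
    by (intro sum.union_disjoint[symmetric]) (auto simp: og_economy_def disjoint_family_on_def)
  have old: "(\<Sum>h\<in>gen E 0. gov_demand_old E q h s i) = (\<Sum>h\<in>gen E 0. demand_old E 1 (rho r q) h s i)"
    for s i
    using assms True by (intro sum.cong) (simp_all add: gov_demand_old_eq_demand_old)
  have young: "(\<Sum>h\<in>gen E t. gov_demand E t (r t) q h s i) = (\<Sum>h\<in>gen E t. demand E t (rho r q) h s i)"
    if "1 \<le> t" for t s i
    using assms True that by (intro sum.cong) (simp_all add: gov_demand_eq_demand)
  \<comment> \<open>From period 2 on, the older generation \<open>t - 1\<close> is at least 1, so
    \<open>young\<close> covers both generations in the market.\<close>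
  have "t - 1 \<noteq> t" "1 \<le> t - 1" "1 \<le> t" if "2 \<le> t" for t :: nat
    using that by auto
  moreover have "q \<in> prices E {1..}"
    using True rho_in_prices_iff[OF assms(3)] by blast
  ultimately show ?thesis
    using True assms(3)
    by (simp add: government_equilibria_def monetary_equilibria_def equilibrium_def
        old young sums del: One_nat_def)
next
  \<comment> \<open>Without positive prices both sides of the equivalence are false.\<close>
  case False
  moreover from this have "q \<notin> prices E {1..}"
    using rho_in_prices_iff[OF assms(3)] by blast
  ultimately show ?thesis
    by (simp add: government_equilibria_def monetary_equilibria_def equilibrium_def)
qed

text \<open>The preimage undoes the discounting. Its positivity and market clearing come from
  \<open>government_equilibrium_iff\<close>.\<close>

lemma surj_rho:
  assumes "r \<in> monetary_policies"
  shows "\<exists>q. rho r q = p"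
proof
  show "rho r (\<lambda>t i. p t i * (\<Prod>k\<in>{1..<t}. 1 + r k)) = p"
    using policy_factor_pos[OF assms] by (auto simp: rho_def fun_eq_iff less_imp_neq[symmetric])
qed

lemma norm_on_rho:
  assumes "r \<in> monetary_policies"
  shows "norm_on E {t} (rho r q) = norm_on E {t} q / (\<Prod>k\<in>{1..<t}. 1 + r k)"
  unfolding rho_def using policy_factor_pos[OF assms] by (rule norm_on_singleton_divide)

text \<open>The discount factor of period \<open>t\<close> cancels, so relative prices depend on
  \<open>(r, q)\<close> only through \<open>rho r q\<close>.\<close>

lemma relative_price_rho:
  assumes "r \<in> monetary_policies"
  shows "rho r q t i / norm_on E {t} (rho r q) = q t i / norm_on E {t} q"
  using policy_factor_pos[OF assms, of t]
  unfolding norm_on_rho[OF assms] by (simp add: rho_def del: prod_zero_iff)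

text \<open>The discount factors of periods \<open>t\<close> and \<open>t + 1\<close> differ by
  exactly \<open>1 + r t\<close>, which absorbs the nominal rate. The real return is thus a function
  of \<open>rho r q\<close> alone.\<close>

lemma real_return_rho:
  assumes "r \<in> monetary_policies" "1 \<le> t"
  shows "real_return E r q t = norm_on E {t} (rho r q) / norm_on E {t + 1} (rho r q) - 1"
proof -
  have "1 + r t > 0"
    using assms by (simp add: monetary_policies_def add_pos_nonneg)
  moreover have "(\<Prod>k\<in>{1..<t + 1}. 1 + r k) = (\<Prod>k\<in>{1..<t}. 1 + r k) * (1 + r t)"
    using assms(2) by simp
  ultimately show ?thesis
    using policy_factor_pos[OF assms(1), of t]
    unfolding real_return_def norm_on_rho[OF assms(1)]
    by (simp add: divide_simps del: prod_zero_iff prod.op_ivl_Suc)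
qed

theorem proposition7:
  fixes E :: "'h og_economy"
  assumes "og_economy E"
    and "single_valued_demand E"
    and "standing_assumptions E"
  shows "(\<forall>r\<in>monetary_policies.
            {rho r q | q. (r, q) \<in> government_equilibria E} = monetary_equilibria E) \<and>
         (\<forall>r q r' q'.
            (r, q) \<in> government_equilibria E \<longrightarrow> (r', q') \<in> government_equilibria E \<longrightarrow>
            rho r q = rho r' q' \<longrightarrow>
              q 1 = q' 1 \<and>
              (\<forall>t\<ge>2. \<forall>i\<in>{1..goods E t}.
                 q t i / norm_on E {t} q = q' t i / norm_on E {t} q') \<and>
              (\<forall>t\<ge>1. real_return E r q t = real_return E r' q' t))"
proof (intro conjI ballI allI impI)
  fix r :: "nat \<Rightarrow> real"
  assume "r \<in> monetary_policies"
  \<comment> \<open>For the inclusion from right to left, \<open>surj_rho\<close> supplies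
    \<open>q\<close> and the equivalence makes \<open>(r, q)\<close> an equilibrium.\<close>
  then show "{rho r q | q. (r, q) \<in> government_equilibria E} = monetary_equilibria E"
    using government_equilibrium_iff[OF assms(1,2)] surj_rho[of r] by (auto, metis)
next
  fix r q r' q'
  assume "(r, q) \<in> government_equilibria E" "(r', q') \<in> government_equilibria E"
    and eq: "rho r q = rho r' q'"
  then have r: "r \<in> monetary_policies" and r': "r' \<in> monetary_policies"
    by (auto simp: government_equilibria_def)
  show "q 1 = q' 1"
    using fun_cong[OF eq, of 1] by (simp add: rho_def)
  show "q t i / norm_on E {t} q = q' t i / norm_on E {t} q'" for t i
    using relative_price_rho[OF r] relative_price_rho[OF r'] eq by metis
  show "real_return E r q t = real_return E r' q' t" if "1 \<le> t" for t
    unfolding real_return_rho[OF r that] real_return_rho[OF r' that] eq ..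
qed

end
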